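(* For every integer $n\geq 2$ and every integer $k\geq 3$, the distinguishing number of the dutch windmill graph $D_n^k$ is $$D(D_n^k)=\min\left\{r\in\mathbb{N}:~\frac{r^{k-1}-r^{\lceil (k-1)/2 \rceil}}{2}\geq n\right\}.$$
   Context: All graphs are simple. The dutch windmill graph $D_n^k$ ($n\geq 2$, $k\geq 3$) is the graph obtained by taking $n$ copies of the cycle $C_k$ and identifying one vertex from each copy into a single common (central) vertex. The distinguishing number $D(G)$ of a graph $G$ is the least number $d$ such that there is a labeling of the vertices of $G$ with $d$ labels that is preserved only by the identity automorphism of $G$. *)

theory Defs
  imports Complex_Main
begin

record 'a graph =
  verts :: "'a set"
  edges :: "'a set set"

definition simple_graph :: "'a graph \<Rightarrow> bool" where
  "simple_graph G \<longleftrightarrow> (\<forall>e\<in>edges G. e \<subseteq> verts G \<and> card e = 2)"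

text \<open>Only the values of \<open>f\<close> on the vertex set matter, so being the identity
  automorphism means fixing every vertex.\<close>

definition graph_automorphism :: "'a graph \<Rightarrow> ('a \<Rightarrow> 'a) \<Rightarrow> bool" where
  "graph_automorphism G f \<longleftrightarrow>
     bij_betw f (verts G) (verts G) \<and>
     (\<forall>u\<in>verts G. \<forall>v\<in>verts G. {u, v} \<in> edges G \<longleftrightarrow> {f u, f v} \<in> edges G)"

definition preserves_labeling :: "'a graph \<Rightarrow> ('a \<Rightarrow> 'l) \<Rightarrow> ('a \<Rightarrow> 'a) \<Rightarrow> bool" where
  "preserves_labeling G c f \<longleftrightarrow> (\<forall>v\<in>verts G. c (f v) = c v)"

definition distinguishing_labeling :: "'a graph \<Rightarrow> ('a \<Rightarrow> 'l) \<Rightarrow> bool" where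
  "distinguishing_labeling G c \<longleftrightarrow>
     (\<forall>f. graph_automorphism G f \<and> preserves_labeling G c f \<longrightarrow> (\<forall>v\<in>verts G. f v = v))"

text \<open>The labels are \<open>0, \<dots>, d - 1\<close>, not all of which need be used. An injective labeling is
  distinguishing, so for a finite graph the least such \<open>d\<close> exists.\<close>

definition distinguishing_number :: "'a graph \<Rightarrow> nat" where
  "distinguishing_number G =
     (LEAST d. \<exists>c :: 'a \<Rightarrow> nat. c ` verts G \<subseteq> {..<d} \<and> distinguishing_labeling G c)"

definition cycle_graph :: "nat \<Rightarrow> nat graph" where
  "cycle_graph k = \<lparr>verts = {..<k}, edges = {{i, (i + 1) mod k} | i. i < k}\<rparr>"

text \<open>Vertex \<open>i\<close> of copy \<open>j\<close> of the cycle; the vertices \<open>0\<close> of all copies are identified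
  into the central vertex \<open>None\<close>.\<close>

definition glue :: "nat \<Rightarrow> nat \<Rightarrow> (nat \<times> nat) option" where
  "glue j i = (if i = 0 then None else Some (j, i))"

definition dutch_windmill :: "nat \<Rightarrow> nat \<Rightarrow> (nat \<times> nat) option graph" where
  "dutch_windmill n k =
     \<lparr>verts = (\<Union>j<n. glue j ` verts (cycle_graph k)),
      edges = (\<Union>j<n. (\<lambda>e. glue j ` e) ` edges (cycle_graph k))\<rparr>"

lemma inj_glue: "inj (glue j)"
  by (auto simp: inj_def glue_def split: if_splits)

lemma simple_cycle_graph:
  assumes "k \<ge> 3"
  shows "simple_graph (cycle_graph k)"
proof -
  have "(i + 1) mod k \<noteq> i" if "i < k" for i
    using assms that by (cases "i + 1 = k") auto
  then show ?thesis
    using assms by (auto simp: simple_graph_def cycle_graph_def card_2_iff)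
qed

lemma simple_dutch_windmill:
  assumes "k \<ge> 3"
  shows "simple_graph (dutch_windmill n k)"
  using simple_cycle_graph[OF assms] inj_glue
  by (fastforce simp: simple_graph_def dutch_windmill_def card_image[OF inj_on_subset[OF inj_glue]])

end

theory Submission imports Defs "HOL-Combinatorics.Transposition" begin

text \<open>
  An automorphism of the windmill fixes the central vertex, the only one of degree greater than
  two. So it permutes the blades, each of which is a path on \<open>k - 1\<close> vertices and can be mapped
  only in two ways, straight or reversed. Reading the labels along a blade gives a word of length
  \<open>k - 1\<close>, and a labeling is distinguishing if and only if these \<open>n\<close> words are not palindromes
  and any two of them differ even up to reversal. There are \<open>r ^ (k - 1)\<close> words over \<open>r\<close> letters, of
  which \<open>r ^ \<lceil>(k - 1) / 2\<rceil>\<close> are palindromes, and reversal pairs up the others.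
\<close>

section \<open>Words up to reversal\<close>

text \<open>A palindrome is determined by its first half, rounded up to include a middle letter, and
  every word of that length is the first half of one.\<close>

lemma card_palindromes:
  assumes "finite A"
  shows "card {xs. set xs \<subseteq> A \<and> length xs = m \<and> rev xs = xs} = card A ^ ((m + 1) div 2)"
proof -
  define h where "h = (m + 1) div 2"
  \<comment> \<open>Only \<open>m div 2\<close> letters are mirrored, so that for odd
    \<open>m\<close> the last letter of \<open>ys\<close> becomes the middle letter and is not
    doubled.\<close>
  define extend :: "'a list \<Rightarrow> 'a list" where "extend ys = ys @ rev (take (m div 2) ys)" for ys
  let ?P = "{xs. set xs \<subseteq> A \<and> length xs = m \<and> rev xs = xs}"
  let ?H = "{ys. set ys \<subseteq> A \<and> length ys = h}"
  have "bij_betw (take h) ?P ?H"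
  proof (rule bij_betw_byWitness[where f' = extend])
    show "\<forall>xs\<in>?P. extend (take h xs) = xs"
    proof
      fix xs assume xs: "xs \<in> ?P"
      then have len: "length xs = m" and pal: "rev xs = xs" by auto
      \<comment> \<open>The last \<open>m div 2\<close> letters begin at position \<open>h\<close>,
        and \<open>rev xs = xs\<close> identifies them with the mirrored first letters.\<close>
      have "rev (take (m div 2) xs) = drop h (rev xs)"
      proof -
        have "m - m div 2 = h" unfolding h_def by presburger
        then show ?thesis using len by (simp add: rev_take)
      qed
      moreover have "take (m div 2) (take h xs) = take (m div 2) xs"
        by (simp add: h_def min_def)
      ultimately show "extend (take h xs) = xs"
        by (simp add: extend_def pal)
    qed
    show "\<forall>ys\<in>?H. take h (extend ys) = ys"
      by (auto simp: extend_def)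
    show "take h ` ?P \<subseteq> ?H"
      by (auto simp: h_def dest: in_set_takeD)
    show "extend ` ?H \<subseteq> ?P"
    proof (rule image_subsetI)
      fix ys :: "'a list" assume "ys \<in> ?H"
      then have ys: "set ys \<subseteq> A" "length ys = h" by auto
      have "set (extend ys) \<subseteq> A"
        using ys by (auto simp: extend_def dest: in_set_takeD)
      moreover have "length (extend ys) = m"
      proof -
        have "m div 2 \<le> h" "h + m div 2 = m" unfolding h_def by presburger+
        then show ?thesis using ys by (simp add: extend_def)
      qed
      moreover have "rev (extend ys) = extend ys"
      proof (cases "even m")
        case True
        then have "take (m div 2) ys = ys" using ys by (simp add: h_def)
        then show ?thesis by (simp add: extend_def)
      next
        case False
        \<comment> \<open>Splitting off the middle letter \<open>z\<close> turns the extension into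
          \<open>zs @ [z] @ rev zs\<close>.\<close>
        then have "length ys = Suc (m div 2)" using ys unfolding h_def by presburger
        then obtain zs z where "ys = zs @ [z]" "length zs = m div 2"
          by (cases ys rule: rev_cases) auto
        then show ?thesis by (simp add: extend_def)
      qed
      ultimately show "extend ys \<in> ?P" by simp
    qed
  qed
  then have "card ?P = card ?H" by (rule bij_betw_same_card)
  then show ?thesis using card_lists_length_eq[OF assms] by (simp add: h_def)
qed

text \<open>The case \<open>i = j\<close> of the second conjunct excludes palindromes. For finite
  \<open>I\<close> the condition thus says that the words and their reversals are
  \<open>2 * card I\<close> different words.\<close>

definition reversal_free :: "'i set \<Rightarrow> ('i \<Rightarrow> 'a list) \<Rightarrow> bool" where
  "reversal_free I w \<longleftrightarrow> inj_on w I \<and> (\<forall>i\<in>I. \<forall>j\<in>I. w i \<noteq> rev (w j))"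

text \<open>The words and their reversals fill \<open>2 * n\<close> places among the
  non-palindromes; conversely, one word can be chosen from each pair of mutually reverse
  non-palindromes. The palindromes stand on the left of the inequality to avoid truncated
  subtraction.\<close>

lemma reversal_free_words_iff:
  fixes A :: "'a set"
  assumes "finite A"
  shows "(\<exists>w :: nat \<Rightarrow> 'a list. (\<forall>j<n. set (w j) \<subseteq> A \<and> length (w j) = m) \<and>
            reversal_free {..<n} w)
         \<longleftrightarrow> 2 * n + card A ^ ((m + 1) div 2) \<le> card A ^ m"
    (is "(\<exists>w. ?words w \<and> _) \<longleftrightarrow> _")
proof -
  let ?W = "{xs. set xs \<subseteq> A \<and> length xs = m}"
  let ?P = "{xs. set xs \<subseteq> A \<and> length xs = m \<and> rev xs = xs}"
  have fin: "finite ?W" by (rule finite_lists_length_eq[OF assms])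
  have finP: "finite ?P" by (rule finite_subset[OF _ fin]) auto
  have "card (?W - ?P) + card ?P = card ?W"
    by (subst card_Un_disjoint[symmetric]) (auto simp: fin finP intro!: arg_cong[where f = card])
  then have card: "card (?W - ?P) + card A ^ ((m + 1) div 2) = card A ^ m"
    by (simp add: card_palindromes[OF assms] card_lists_length_eq[OF assms])
  have "(\<exists>w. ?words w \<and> reversal_free {..<n} w) \<longleftrightarrow> 2 * n \<le> card (?W - ?P)"
  proof
    assume "\<exists>w. ?words w \<and> reversal_free {..<n} w"
    then obtain w where words: "?words w" and inj: "inj_on w {..<n}"
      and rev: "\<And>i j. i < n \<Longrightarrow> j < n \<Longrightarrow> w i \<noteq> rev (w j)"
      by (auto simp: reversal_free_def)
    have "2 * n = card (w ` {..<n}) + card (rev ` w ` {..<n})"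
      using inj by (simp add: card_image)
    also have "\<dots> = card (w ` {..<n} \<union> rev ` w ` {..<n})"
      using rev by (intro card_Un_disjoint[symmetric]) auto
    also have "\<dots> \<le> card (?W - ?P)"
    proof (rule card_mono)
      have "w i \<in> ?W - ?P" "rev (w i) \<in> ?W - ?P" if "i < n" for i
        using rev[OF that that] words that by auto
      then show "w ` {..<n} \<union> rev ` w ` {..<n} \<subseteq> ?W - ?P" by blast
    qed (use fin in simp)
    finally show "2 * n \<le> card (?W - ?P)" .
  next
    assume n: "2 * n \<le> card (?W - ?P)"
    \<comment> \<open>The letters carry no order, so an arbitrary injective numbering
      \<open>e\<close> decides which word of a pair \<open>xs\<close>, \<open>rev xs\<close> enters
      \<open>R\<close>. The strict inequality leaves palindromes out.\<close>
    obtain e :: "'a list \<Rightarrow> nat" where e: "inj_on e ?W"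
      using finite_imp_inj_to_nat_seg[OF fin] by blast
    define R where "R = {xs \<in> ?W. e xs < e (rev xs)}"
    have finR: "finite R" by (rule finite_subset[OF _ fin]) (auto simp: R_def)
    have "?W - ?P \<subseteq> R \<union> rev ` R"
    proof
      fix xs assume xs: "xs \<in> ?W - ?P"
      then have "e xs \<noteq> e (rev xs)" using inj_onD[OF e, of xs "rev xs"] by auto
      then have "xs \<in> R \<or> rev xs \<in> R" using xs by (auto simp: R_def)
      then show "xs \<in> R \<union> rev ` R" by (auto intro: image_eqI[of xs rev "rev xs"])
    qed
    then have "card (?W - ?P) \<le> card (R \<union> rev ` R)"
      using finR by (intro card_mono) auto
    also have "\<dots> \<le> card R + card (rev ` R)" by (rule card_Un_le)
    also have "\<dots> = 2 * card R" by (simp add: card_image)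
    finally have "card {..<n} \<le> card R" using n by simp
    then obtain w where w: "w ` {..<n} \<subseteq> R" "inj_on w {..<n}"
      using finR by (meson card_le_inj finite_lessThan)
    have "w i \<noteq> rev (w j)" if "i < n" "j < n" for i j
    proof
      \<comment> \<open>Membership of \<open>w i\<close> and of \<open>w j\<close> in
        \<open>R\<close> would then compare the same two numbers in opposite ways.\<close>
      assume eq: "w i = rev (w j)"
      have "w i \<in> R" "w j \<in> R" using w that by auto
      then show False by (simp add: R_def eq)
    qed
    then show "\<exists>w. ?words w \<and> reversal_free {..<n} w"
      using w by (intro exI[of _ w]) (auto simp: reversal_free_def R_def)
  qed
  also have "\<dots> \<longleftrightarrow> 2 * n + card A ^ ((m + 1) div 2) \<le> card A ^ m"
    using card by linarith
  finally show ?thesis .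
qed

section \<open>Automorphisms of the windmill\<close>

lemma verts_dutch_windmill:
  assumes "n \<ge> 1" "k \<ge> 1"
  shows "verts (dutch_windmill n k) = insert None {Some (j, i) | j i. j < n \<and> 0 < i \<and> i < k}"
proof -
  have "None \<in> verts (dutch_windmill n k)"
    using assms by (auto simp: dutch_windmill_def cycle_graph_def glue_def image_iff
        lessThan_empty_iff intro!: bexI[of _ 0])
  then show ?thesis
    by (auto simp: dutch_windmill_def cycle_graph_def glue_def split: if_splits)
qed

lemma edge_dutch_windmill_iff:
  "{u, v} \<in> edges (dutch_windmill n k) \<longleftrightarrow>
     (\<exists>j<n. \<exists>i<k. (u = glue j i \<and> v = glue j ((i + 1) mod k)) \<or>
                  (v = glue j i \<and> u = glue j ((i + 1) mod k)))"
  by (auto simp: dutch_windmill_def cycle_graph_def doubleton_eq_iff image_iff; blast)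

lemma Suc_mod_cases:
  assumes "i < k"
  shows "Suc i < k \<and> Suc i mod k = Suc i \<or> Suc i = k \<and> Suc i mod k = 0"
  using assms by (cases "Suc i = k") auto

text \<open>The centre is position 0 of every cycle, so it meets a blade through the edge leaving
  position 0 and through the closing edge from \<open>k - 1\<close> back to 0.\<close>

lemma center_edge_iff:
  assumes "k \<ge> 3" "j < n" "0 < i" "i < k"
  shows "{None, Some (j, i)} \<in> edges (dutch_windmill n k) \<longleftrightarrow> i = 1 \<or> i = k - 1"
proof
  assume "{None, Some (j, i)} \<in> edges (dutch_windmill n k)"
  then obtain l where "l < k" "l = 0 \<and> Suc l mod k = i \<or> l = i \<and> Suc l mod k = 0"
    by (auto simp: edge_dutch_windmill_iff glue_def split: if_splits)
  then show "i = 1 \<or> i = k - 1"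
    using Suc_mod_cases[of l k] assms by auto
next
  assume "i = 1 \<or> i = k - 1"
  then show "{None, Some (j, i)} \<in> edges (dutch_windmill n k)"
    unfolding edge_dutch_windmill_iff
  proof
    assume "i = 1"
    then show "\<exists>j'<n. \<exists>l<k. (None = glue j' l \<and> Some (j, i) = glue j' ((l + 1) mod k)) \<or>
                  (Some (j, i) = glue j' l \<and> None = glue j' ((l + 1) mod k))"
      using assms by (intro exI[of _ j] conjI exI[of _ 0]) (auto simp: glue_def)
  next
    assume "i = k - 1"
    then show "\<exists>j'<n. \<exists>l<k. (None = glue j' l \<and> Some (j, i) = glue j' ((l + 1) mod k)) \<or>
                  (Some (j, i) = glue j' l \<and> None = glue j' ((l + 1) mod k))"
      using assms by (intro exI[of _ j] conjI exI[of _ i]) (auto simp: glue_def)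
  qed
qed

text \<open>The closing edge of a cycle passes through the centre, so what remains of the cycle
  without the centre is a path.\<close>

lemma blade_edge_iff:
  assumes "j < n" "0 < i" "i < k" "0 < i'" "i' < k"
  shows "{Some (j, i), Some (j', i')} \<in> edges (dutch_windmill n k) \<longleftrightarrow>
         j' = j \<and> (i' = Suc i \<or> i = Suc i')"
proof
  assume "{Some (j, i), Some (j', i')} \<in> edges (dutch_windmill n k)"
  then obtain l where "l < k" "j' = j" "l = i \<and> Suc l mod k = i' \<or> l = i' \<and> Suc l mod k = i"
    by (auto simp: edge_dutch_windmill_iff glue_def split: if_splits)
  then show "j' = j \<and> (i' = Suc i \<or> i = Suc i')"
    using Suc_mod_cases[of l k] assms by auto
next
  assume "j' = j \<and> (i' = Suc i \<or> i = Suc i')"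
  then show "{Some (j, i), Some (j', i')} \<in> edges (dutch_windmill n k)"
    unfolding edge_dutch_windmill_iff
    using assms by (intro exI[of _ j] conjI exI[of _ "min i i'"]) (auto simp: glue_def)
qed

text \<open>This bounds the degree of every vertex other than the centre by two. Using
  \<open>glue\<close> covers the ends of the blade, where one of the two candidates is the
  centre.\<close>

lemma blade_neighbour:
  assumes "0 < i" "i < k" "{Some (j, i), v} \<in> edges (dutch_windmill n k)"
  shows "v = glue j (Suc i mod k) \<or> v = glue j (i - 1)"
proof -
  obtain j' l where "l < k" "Some (j, i) = glue j' l \<and> v = glue j' (Suc l mod k) \<or>
      v = glue j' l \<and> Some (j, i) = glue j' (Suc l mod k)"
    using assms by (auto simp: edge_dutch_windmill_iff)
  moreover have "j' = j \<and> l' = i" if "Some (j, i) = glue j' l'" for l'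
    using that by (auto simp: glue_def split: if_splits)
  ultimately have "l < k" "l = i \<and> v = glue j (Suc l mod k) \<or> v = glue j l \<and> Suc l mod k = i"
    by blast+
  then show ?thesis using Suc_mod_cases[of l k] assms by auto
qed

section \<open>Automorphisms that permute and reverse blades\<close>

text \<open>\<open>F\<close> collects the blades, named by their old index, that are reversed on the
  way. The centre is \<open>None\<close>, which \<open>map_option\<close> fixes.\<close>

definition blade_map ::
    "nat \<Rightarrow> (nat \<Rightarrow> nat) \<Rightarrow> nat set \<Rightarrow> (nat \<times> nat) option \<Rightarrow> (nat \<times> nat) option" where
  "blade_map k \<sigma> F = map_option (\<lambda>(j, i). (\<sigma> j, if j \<in> F then k - i else i))"

text \<open>The reflection sending \<open>i\<close> to \<open>k - i\<close> exchanges the two ends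
  of a blade and keeps consecutive positions consecutive, so edges at the centre and edges inside
  blades are both respected.\<close>

lemma graph_automorphism_blade_map:
  assumes n: "n \<ge> 1" and k: "k \<ge> 3" and \<sigma>: "bij_betw \<sigma> {..<n} {..<n}"
  shows "graph_automorphism (dutch_windmill n k) (blade_map k \<sigma> F)"
proof -
  let ?f = "blade_map k \<sigma> F" and ?E = "edges (dutch_windmill n k)"
  have V: "verts (dutch_windmill n k) = insert None {Some (j, i) | j i. j < n \<and> 0 < i \<and> i < k}"
    using n k by (intro verts_dutch_windmill) auto
  have lt: "\<sigma> j < n" if "j < n" for j using \<sigma> that by (auto simp: bij_betw_def)
  have eq: "\<sigma> j = \<sigma> j' \<longleftrightarrow> j = j'" if "j < n" "j' < n" for j j'
    using \<sigma> that by (auto simp: bij_betw_def inj_on_def)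
  have "inj_on ?f (verts (dutch_windmill n k))"
    unfolding V by (rule inj_onI) (auto simp: blade_map_def eq split: if_splits)
  moreover have "?f ` verts (dutch_windmill n k) \<subseteq> verts (dutch_windmill n k)"
    unfolding V by (auto simp: blade_map_def lt)
  moreover have "finite (verts (dutch_windmill n k))"
    by (auto simp: dutch_windmill_def cycle_graph_def)
  ultimately have "bij_betw ?f (verts (dutch_windmill n k)) (verts (dutch_windmill n k))"
    by (metis bij_betw_def endo_inj_surj)
  moreover have "{None, Some (j, i)} \<in> ?E \<longleftrightarrow> {?f None, ?f (Some (j, i))} \<in> ?E"
    if "j < n" "0 < i" "i < k" for j i
    using that k lt[OF that(1)]
    by (auto simp: blade_map_def center_edge_iff)
  moreover have "{Some (j, i), Some (j', i')} \<in> ?E \<longleftrightarrow> {?f (Some (j, i)), ?f (Some (j', i'))} \<in> ?E"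
    if "j < n" "0 < i" "i < k" "j' < n" "0 < i'" "i' < k" for j i j' i'
    using that lt[of j] lt[of j'] eq[of j j']
    by (auto simp: blade_map_def blade_edge_iff)
  moreover have "{None, None} \<in> ?E \<longleftrightarrow> {?f None, ?f None} \<in> ?E"
    by (simp add: blade_map_def)
  ultimately show ?thesis
    unfolding graph_automorphism_def V by (auto simp: insert_commute)
qed

section \<open>Rigidity of arbitrary automorphisms\<close>

text \<open>A degree argument: three neighbours of the centre would be mapped injectively to
  neighbours of a blade vertex, which has at most two.\<close>

lemma automorphism_fixes_center:
  assumes n: "n \<ge> 2" and k: "k \<ge> 3" and f: "graph_automorphism (dutch_windmill n k) f"
  shows "f None = None"
proof (rule ccontr)
  let ?V = "verts (dutch_windmill n k)" and ?E = "edges (dutch_windmill n k)"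
  have V: "?V = insert None {Some (j, i) | j i. j < n \<and> 0 < i \<and> i < k}"
    using n k by (intro verts_dutch_windmill) auto
  assume "f None \<noteq> None"
  moreover have "f None \<in> ?V" using f by (auto simp: graph_automorphism_def bij_betw_def V)
  ultimately obtain j i where fN: "f None = Some (j, i)" "j < n" "0 < i" "i < k"
    by (auto simp: V)
  \<comment> \<open>Both ends of blade 0 and one end of blade 1; they are distinct since
    \<open>k \<ge> 3\<close>, and blade 1 exists since \<open>n \<ge> 2\<close>.\<close>
  let ?N = "{Some (0 :: nat, 1 :: nat), Some (0, k - 1), Some (1, 1)}"
  have "?N \<subseteq> ?V" using n k by (auto simp: V)
  moreover have "inj_on f ?V" using f by (simp add: graph_automorphism_def bij_betw_def)
  ultimately have "inj_on f ?N" by (rule inj_on_subset[rotated])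
  then have "card (f ` ?N) = card ?N" by (rule card_image)
  also have "\<dots> = 3" using k by auto
  finally have "card (f ` ?N) = 3" .
  have "f v \<in> {glue j (Suc i mod k), glue j (i - 1)}" if "v \<in> ?N" for v
  proof -
    have "{None, v} \<in> ?E" using that n k by (auto simp: center_edge_iff)
    then have "{f None, f v} \<in> ?E"
      using f that \<open>?N \<subseteq> ?V\<close> unfolding graph_automorphism_def V by blast
    then show ?thesis using blade_neighbour fN by auto
  qed
  then have "f ` ?N \<subseteq> {glue j (Suc i mod k), glue j (i - 1)}" by blast
  then have "card (f ` ?N) \<le> card {glue j (Suc i mod k), glue j (i - 1)}"
    by (intro card_mono) auto
  also have "\<dots> \<le> 2" by (simp add: card_insert_if)
  finally show False using \<open>card (f ` ?N) = 3\<close> by simp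
qed

text \<open>The image of a blade is a walk that starts next to the fixed centre, hence at an end of
  some blade. It avoids the centre, so it stays on that blade, and injectivity forbids turning back.
  The starting end therefore determines the whole walk.\<close>

lemma automorphism_maps_blade:
  assumes n: "n \<ge> 2" and k: "k \<ge> 3" and f: "graph_automorphism (dutch_windmill n k) f"
    and j: "j < n"
  obtains j' where "j' < n"
    and "(\<forall>i. 0 < i \<and> i < k \<longrightarrow> f (Some (j, i)) = Some (j', i)) \<or>
         (\<forall>i. 0 < i \<and> i < k \<longrightarrow> f (Some (j, i)) = Some (j', k - i))"
proof -
  let ?V = "verts (dutch_windmill n k)" and ?E = "edges (dutch_windmill n k)"
  have V: "?V = insert None {Some (j, i) | j i. j < n \<and> 0 < i \<and> i < k}"
    using n k by (intro verts_dutch_windmill) auto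
  have N: "f None = None" by (rule automorphism_fixes_center[OF n k f])
  have edge: "{f u, f v} \<in> ?E" if "u \<in> ?V" "v \<in> ?V" "{u, v} \<in> ?E" for u v
    using f that by (auto simp: graph_automorphism_def bij_betw_def)
  have inj: "inj_on f ?V" and im: "f ` ?V = ?V"
    using f by (auto simp: graph_automorphism_def bij_betw_def)
  have blade: "\<exists>j' i'. f (Some (j, i)) = Some (j', i') \<and> j' < n \<and> 0 < i' \<and> i' < k"
    if "0 < i" "i < k" for i
  proof -
    have v: "Some (j, i) \<in> ?V" using that j by (auto simp: V)
    have "f (Some (j, i)) \<noteq> None"
    proof
      assume "f (Some (j, i)) = None"
      then have "Some (j, i) = None" using N v by (intro inj_onD[OF inj _ v]) (simp_all add: V)
      then show False by simp
    qed
    moreover have "f (Some (j, i)) \<in> insert None {Some (j', i') | j' i'. j' < n \<and> 0 < i' \<and> i' < k}"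
      using imageI[OF v, of f] unfolding im by (simp only: V)
    ultimately show ?thesis unfolding insert_iff mem_Collect_eq by meson
  qed
  obtain j' i1 where f1: "f (Some (j, 1)) = Some (j', i1)" "j' < n" "0 < i1" "i1 < k"
    using blade[of 1] k by auto
  have "{f None, f (Some (j, 1))} \<in> ?E"
    using k j by (intro edge) (auto simp: V center_edge_iff)
  then have i1: "i1 = 1 \<or> i1 = k - 1"
    using f1 k by (auto simp: N center_edge_iff)
  have step: "\<exists>i'. f (Some (j, Suc i)) = Some (j', i') \<and> 0 < i' \<and> i' < k \<and> (i' = Suc l \<or> l = Suc i')"
    if il: "f (Some (j, i)) = Some (j', l)" "0 < l" "l < k" "0 < i" "Suc i < k" for i l
  proof -
    obtain j2 i' where f2: "f (Some (j, Suc i)) = Some (j2, i')" "j2 < n" "0 < i'" "i' < k"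
      using blade[OF _ il(5)] by auto
    have "{f (Some (j, i)), f (Some (j, Suc i))} \<in> ?E"
      using j il by (intro edge) (auto simp: V blade_edge_iff)
    then show ?thesis using il f1(2) f2 by (auto simp: blade_edge_iff)
  qed
  \<comment> \<open>This is the only use of injectivity along the walk: two steps never lead back to
    the same vertex.\<close>
  have no_return: "f (Some (j, Suc (Suc i))) \<noteq> f (Some (j, i))" if "0 < i" "Suc (Suc i) < k" for i
    using inj_onD[OF inj, of "Some (j, Suc (Suc i))" "Some (j, i)"] that j by (auto simp: V)
  from i1 have "(\<forall>i. 0 < i \<and> i < k \<longrightarrow> f (Some (j, i)) = Some (j', i)) \<or>
         (\<forall>i. 0 < i \<and> i < k \<longrightarrow> f (Some (j, i)) = Some (j', k - i))"
  proof
    assume "i1 = 1"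
    \<comment> \<open>The induction is strong because excluding a turn needs the images of the two
      preceding vertices.\<close>
    have "f (Some (j, i)) = Some (j', i)" if "0 < i" "i < k" for i
      using that
    proof (induction i rule: less_induct)
      case (less i)
      show ?case
      proof (cases "i = 1")
        case True then show ?thesis using f1 \<open>i1 = 1\<close> by simp
      next
        case False
        then obtain l where l: "i = Suc l" "0 < l" using less.prems by (cases i) auto
        have "f (Some (j, l)) = Some (j', l)" using less l by auto
        then obtain i' where i': "f (Some (j, i)) = Some (j', i')" "0 < i'" "i' = i \<or> l = Suc i'"
          using step[of l l] less.prems l by auto
        \<comment> \<open>Otherwise \<open>i'\<close> is the position two before \<open>i\<close>,
          and by induction it is already the image of that position.\<close>
        have "l \<noteq> Suc i'"
          using no_return[of i'] less.IH[of i'] less.prems i' l by auto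
        then show ?thesis using i' by simp
      qed
    qed
    then show ?thesis by blast
  next
    assume "i1 = k - 1"
    have "f (Some (j, i)) = Some (j', k - i)" if "0 < i" "i < k" for i
      using that
    proof (induction i rule: less_induct)
      case (less i)
      show ?case
      proof (cases "i = 1")
        case True then show ?thesis using f1 \<open>i1 = k - 1\<close> by simp
      next
        case False
        then obtain l where l: "i = Suc l" "0 < l" using less.prems by (cases i) auto
        have "f (Some (j, l)) = Some (j', k - l)" using less l by auto
        then obtain i' where i': "f (Some (j, i)) = Some (j', i')" "i' < k"
            "i' = Suc (k - l) \<or> k - l = Suc i'"
          using step[of l "k - l"] less.prems l by auto
        \<comment> \<open>For \<open>l = 1\<close> this value would be \<open>k\<close>, outside the
          blade. For larger \<open>l\<close> it is already taken by the image of the predecessor of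
          \<open>l\<close>.\<close>
        have "i' \<noteq> Suc (k - l)"
        proof
          assume a: "i' = Suc (k - l)"
          then have "l \<noteq> 1" using i' less.prems by auto
          then obtain p where "l = Suc p" "0 < p" using l by (cases l) auto
          then show False
            using no_return[of p] less.IH[of p] less.prems i' l a by (auto simp: Suc_diff_Suc)
        qed
        then show ?thesis using i' l less.prems by auto
      qed
    qed
    then show ?thesis by blast
  qed
  then show thesis using that f1(2) by blast
qed

section \<open>Distinguishing labelings of the windmill\<close>

text \<open>The label of the centre is left out: all automorphisms fix the centre, so its label
  distinguishes nothing.\<close>

definition blade_word :: "nat \<Rightarrow> ((nat \<times> nat) option \<Rightarrow> 'l) \<Rightarrow> nat \<Rightarrow> 'l list" where
  "blade_word k c j = map (\<lambda>i. c (Some (j, i))) [1..<k]"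

lemma blade_word_eq_iff:
  "blade_word k c j = blade_word k c j' \<longleftrightarrow>
     (\<forall>i. 0 < i \<and> i < k \<longrightarrow> c (Some (j, i)) = c (Some (j', i)))"
  by (auto simp: blade_word_def)

lemma rev_blade_word:
  "rev (blade_word k c j) = map (\<lambda>i. c (Some (j, k - i))) [1..<k]"
  by (rule nth_equalityI) (auto simp: blade_word_def rev_nth intro!: arg_cong[where f = c])

lemma blade_word_eq_rev_iff:
  "blade_word k c j = rev (blade_word k c j') \<longleftrightarrow>
     (\<forall>i. 0 < i \<and> i < k \<longrightarrow> c (Some (j, i)) = c (Some (j', k - i)))"
  unfolding rev_blade_word by (auto simp: blade_word_def)

text \<open>Each violation of \<open>reversal_free\<close> yields a nontrivial automorphism
  preserving the labels: equal words allow swapping two blades, and mutually reverse words allow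
  swapping them with both reversed. Conversely, an automorphism preserving the labels matches the
  word of each blade with that of its image, straight or reversed, so every blade is fixed
  pointwise.\<close>

lemma distinguishing_labeling_dutch_windmill_iff:
  assumes n: "n \<ge> 2" and k: "k \<ge> 3"
  shows "distinguishing_labeling (dutch_windmill n k) c \<longleftrightarrow>
         reversal_free {..<n} (blade_word k c)"
proof
  let ?G = "dutch_windmill n k"
  have V: "verts ?G = insert None {Some (j, i) | j i. j < n \<and> 0 < i \<and> i < k}"
    using n k by (intro verts_dutch_windmill) auto
  assume dist: "distinguishing_labeling ?G c"
  \<comment> \<open>Position 1 is a sufficient test vertex: a proper swap changes its blade, and for
    \<open>j = j'\<close> a reversal moves it to \<open>k - 1\<close>.\<close>
  have fixed: "blade_map k (transpose j j') F (Some (j, 1)) = Some (j, 1)"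
    if "j < n" "j' < n" "preserves_labeling ?G c (blade_map k (transpose j j') F)" for j j' F
  proof -
    have "bij_betw (transpose j j') {..<n} {..<n}"
      using that by simp
    then have "graph_automorphism ?G (blade_map k (transpose j j') F)"
      using n k by (intro graph_automorphism_blade_map) auto
    then show ?thesis
      using dist that k unfolding distinguishing_labeling_def by (auto simp: V)
  qed
  show "reversal_free {..<n} (blade_word k c)"
    unfolding reversal_free_def
  proof (intro conjI inj_onI ballI notI)
    fix j j' assume jj: "j \<in> {..<n}" "j' \<in> {..<n}"
      and eq: "blade_word k c j = blade_word k c j'"
    have "preserves_labeling ?G c (blade_map k (transpose j j') {})"
      unfolding preserves_labeling_def
      using eq by (auto simp: V blade_map_def blade_word_eq_iff transpose_def)
    from fixed[OF _ _ this] jj show "j = j'" by (simp add: blade_map_def)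
  next
    fix j j' assume jj: "j \<in> {..<n}" "j' \<in> {..<n}"
      and eq: "blade_word k c j = rev (blade_word k c j')"
    \<comment> \<open>The swap moves both blades, so labels must agree in both directions. For
      \<open>j = j'\<close> the map just reverses a palindromic blade.\<close>
    from eq have eq': "blade_word k c j' = rev (blade_word k c j)" by simp
    have "preserves_labeling ?G c (blade_map k (transpose j j') {j, j'})"
      unfolding preserves_labeling_def
      using eq eq' unfolding blade_word_eq_rev_iff by (auto simp: V blade_map_def transpose_def)
    from fixed[OF _ _ this] jj k show False by (auto simp: blade_map_def)
  qed
next
  let ?G = "dutch_windmill n k"
  have V: "verts ?G = insert None {Some (j, i) | j i. j < n \<and> 0 < i \<and> i < k}"
    using n k by (intro verts_dutch_windmill) auto
  assume free: "reversal_free {..<n} (blade_word k c)"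
  show "distinguishing_labeling ?G c"
    unfolding distinguishing_labeling_def
  proof (intro allI impI ballI)
    fix f v assume "graph_automorphism ?G f \<and> preserves_labeling ?G c f" and v: "v \<in> verts ?G"
    then have f: "graph_automorphism ?G f" and lab: "\<And>v. v \<in> verts ?G \<Longrightarrow> c (f v) = c v"
      by (auto simp: preserves_labeling_def)
    show "f v = v"
    proof (cases "v = None")
      case True
      then show ?thesis using automorphism_fixes_center[OF n k f] by simp
    next
      case False
      then obtain j i where ji: "v = Some (j, i)" "j < n" "0 < i" "i < k" using v by (auto simp: V)
      have lab': "c (Some (j, i)) = c (f (Some (j, i)))" if "0 < i" "i < k" for i
        using lab[of "Some (j, i)"] ji that by (auto simp: V)
      obtain j' where "j' < n"
        and "(\<forall>i. 0 < i \<and> i < k \<longrightarrow> f (Some (j, i)) = Some (j', i)) \<or>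
         (\<forall>i. 0 < i \<and> i < k \<longrightarrow> f (Some (j, i)) = Some (j', k - i))"
        using automorphism_maps_blade[OF n k f ji(2)] by blast
      from this(2) show ?thesis
      proof
        assume st: "\<forall>i. 0 < i \<and> i < k \<longrightarrow> f (Some (j, i)) = Some (j', i)"
        then have "blade_word k c j = blade_word k c j'"
          using lab' by (auto simp: blade_word_eq_iff)
        then have "j = j'"
          using free \<open>j' < n\<close> ji by (auto simp: reversal_free_def inj_on_def)
        then show ?thesis using st ji by simp
      next
        assume "\<forall>i. 0 < i \<and> i < k \<longrightarrow> f (Some (j, i)) = Some (j', k - i)"
        then have "blade_word k c j = rev (blade_word k c j')"
          using lab' unfolding blade_word_eq_rev_iff by auto
        then show ?thesis
          using free \<open>j' < n\<close> ji by (auto simp: reversal_free_def)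
      qed
    qed
  qed
qed

text \<open>Labelings correspond to families of \<open>n\<close> words of length
  \<open>k - 1\<close>, up to the label of the centre; the palindrome exponent is then
  \<open>((k - 1) + 1) div 2 = k div 2\<close>.\<close>

lemma ex_distinguishing_labeling_dutch_windmill_iff:
  assumes n: "n \<ge> 2" and k: "k \<ge> 3"
  shows "(\<exists>c :: _ \<Rightarrow> nat. c ` verts (dutch_windmill n k) \<subseteq> {..<d} \<and>
            distinguishing_labeling (dutch_windmill n k) c)
         \<longleftrightarrow> 2 * n + d ^ (k div 2) \<le> d ^ (k - 1)"
proof -
  let ?G = "dutch_windmill n k"
  have V: "verts ?G = insert None {Some (j, i) | j i. j < n \<and> 0 < i \<and> i < k}"
    using n k by (intro verts_dutch_windmill) auto
  have "(\<exists>c :: _ \<Rightarrow> nat. c ` verts ?G \<subseteq> {..<d} \<and> distinguishing_labeling ?G c) \<longleftrightarrow>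
        (\<exists>w. (\<forall>j<n. set (w j) \<subseteq> {..<d} \<and> length (w j) = k - 1) \<and> reversal_free {..<n} w)"
  proof
    assume "\<exists>c :: _ \<Rightarrow> nat. c ` verts ?G \<subseteq> {..<d} \<and> distinguishing_labeling ?G c"
    then obtain c :: "_ \<Rightarrow> nat" where c: "c ` verts ?G \<subseteq> {..<d}" "distinguishing_labeling ?G c"
      by blast
    then show "\<exists>w. (\<forall>j<n. set (w j) \<subseteq> {..<d} \<and> length (w j) = k - 1) \<and> reversal_free {..<n} w"
    proof (intro exI conjI allI impI)
      show "set (blade_word k c j) \<subseteq> {..<d}" if "j < n" for j
      proof
        fix x assume "x \<in> set (blade_word k c j)"
        then obtain i where "x = c (Some (j, i))" "0 < i" "i < k"
          by (auto simp: blade_word_def)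
        then show "x \<in> {..<d}" using c(1) that by (auto simp: V image_subset_iff)
      qed
      show "reversal_free {..<n} (blade_word k c)"
        using c(2) distinguishing_labeling_dutch_windmill_iff[OF n k] by blast
    qed (simp add: blade_word_def)
  next
    assume "\<exists>w. (\<forall>j<n. set (w j) \<subseteq> {..<d} \<and> length (w j) = k - 1) \<and> reversal_free {..<n} w"
    then obtain w where w: "\<And>j. j < n \<Longrightarrow> set (w j) \<subseteq> {..<d}" "\<And>j. j < n \<Longrightarrow> length (w j) = k - 1"
      and free: "reversal_free {..<n} w" by blast
    \<comment> \<open>The label 0 of the centre is arbitrary. The shift \<open>i - 1\<close> arises
      because blade positions start at 1 and list indices at 0.\<close>
    define c where "c v = (case v of None \<Rightarrow> 0 | Some (j, i) \<Rightarrow> w j ! (i - 1))" for v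
    have word: "blade_word k c j = w j" if "j < n" for j
      using w(2)[OF that] by (intro nth_equalityI) (auto simp: blade_word_def c_def)
    have lt: "w j ! (i - 1) < d" if "j < n" "0 < i" "i < k" for j i
    proof -
      have "w j ! (i - 1) \<in> set (w j)" using w(2)[OF that(1)] that by (intro nth_mem) simp
      then show ?thesis using w(1)[OF that(1)] by blast
    qed
    \<comment> \<open>Some word has a letter, so the label 0 chosen for the centre is
      available.\<close>
    have "0 < d" using lt[of 0 1] n k by auto
    then have "c ` verts ?G \<subseteq> {..<d}" using lt by (auto simp: V c_def)
    moreover have "reversal_free {..<n} (blade_word k c)"
      using free by (simp add: reversal_free_def word inj_on_def)
    ultimately show "\<exists>c :: _ \<Rightarrow> nat. c ` verts ?G \<subseteq> {..<d} \<and> distinguishing_labeling ?G c"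
      using distinguishing_labeling_dutch_windmill_iff[OF n k] by blast
  qed
  also have "\<dots> \<longleftrightarrow> 2 * n + d ^ (k div 2) \<le> d ^ (k - 1)"
    using reversal_free_words_iff[of "{..<d}" n "k - 1"] k by simp
  finally show ?thesis .
qed

theorem theorem2p1:
  fixes n k :: nat
  assumes "n \<ge> 2" and "k \<ge> 3"
  shows "distinguishing_number (dutch_windmill n k) =
    (LEAST r :: nat.
       (real r ^ (k - 1) - real r ^ nat \<lceil>(real k - 1) / 2\<rceil>) / 2 \<ge> real n)"
proof -
  have h: "nat \<lceil>(real k - 1) / 2\<rceil> = k div 2"
  proof (cases "even k")
    case True
    then obtain q where "k = 2 * q" by (rule evenE)
    moreover have "\<lceil>(2 * real q - 1) / 2\<rceil> = int q"
      by (rule ceiling_unique) auto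
    ultimately show ?thesis by simp
  next
    case False
    then obtain q where "k = 2 * q + 1" by (rule oddE)
    then show ?thesis by simp
  qed
  \<comment> \<open>Both minima range over equivalent conditions; over the reals the subtraction is
    genuine, so the terms can be rearranged.\<close>
  have "2 * n + r ^ (k div 2) \<le> r ^ (k - 1) \<longleftrightarrow>
      real n \<le> (real r ^ (k - 1) - real r ^ (k div 2)) / 2" for r :: nat
  proof -
    have "2 * n + r ^ (k div 2) \<le> r ^ (k - 1) \<longleftrightarrow>
        real (2 * n + r ^ (k div 2)) \<le> real (r ^ (k - 1))"
      by (rule of_nat_le_iff[symmetric])
    then show ?thesis by (simp add: field_simps)
  qed
  then show ?thesis
    unfolding distinguishing_number_def h
    by (simp add: ex_distinguishing_labeling_dutch_windmill_iff[OF assms])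
qed

end
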